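(* Let $p$ be an odd prime, let $\eta,r\in\mathbb{N}$ with $1\le r\le\eta$, let $H:=\mathbb{Z}_{p^\eta}$ with the trivial linear cycle set structure and $I:=\mathbb{Z}_{p^r}$. Let $a,b\in\mathbb{Z}_{p^r}$ satisfy $a^{p^\eta}=1$, $p^\eta b=0$, $b^2=0$, and let $\beta,u,q$ be attached to $(a,b)$ as in the context. For each pair $$(\gamma,\mathfrak{f}_0)\in\bigl\{(p^{\,r-\min(u+1,\beta)}z_1,\;z_2)\in\mathbb{Z}_{p^r}\oplus\mathbb{Z}_{p^r}:\ 0\le z_1<p^{\min(u+1,\beta)},\ 0\le z_2<p^{q}\bigr\},$$ the socle of the linear cycle set $E_{\gamma,\mathfrak{f}_0}$ is $$\operatorname{Soc}(E_{\gamma,\mathfrak{f}_0})=\bigl\{y+w_h\in E_{\gamma,\mathfrak{f}_0}:\ p^{r-u-1}\mid h\ \text{ and }\ h\mathfrak{f}_0=-by\bigr\},$$ where the equality $h\mathfrak{f}_0=-by$ is in $\mathbb{Z}_{p^r}$.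
   Context: $\mathbb{Z}_n$ denotes the ring of integers modulo $n$. An expression such as $0\le z<p^m$ for $z\in\mathbb{Z}_{p^r}$ means that $z$ is the class of an integer (also denoted $z$) in that range. Elements of $H=\mathbb{Z}_{p^\eta}$ are always represented by integers $0\le h<p^\eta$. A linear cycle set is an additive abelian group $L$ with a binary operation $\cdot$ such that all maps $m\mapsto l\cdot m$ are bijective, $l\cdot(m+n)=l\cdot m+l\cdot n$ and $(l+m)\cdot n=(l\cdot m)\cdot(l\cdot n)$ for all $l,m,n\in L$. It is trivial if $l\cdot m=m$ for all $l,m$. The socle of $L$ is $\operatorname{Soc}(L)=\{x\in L: x\cdot m=m\text{ for all }m\in L\}$. Integers attached to $(a,b)$. If $b\neq0$, write $b=p^\beta k'$ with $0\le\beta<r$ and $p\nmid k'$; if $b=0$, set $\beta:=r$. One has $a=1+pk$ for some $k$; if $a\neq1$, write $a-1=p^{u+1}s$ with $0\le u<r-1$ and $p\nmid s$; if $a=1$, set $u:=r-1$. The integer $q$ is the largest one $\le r$ such that $p^q\mid ba+a-1$ in $\mathbb{Z}_{p^r}$. For $\gamma,\mathfrak{f}_0\in\mathbb{Z}_{p^r}$ and integers $0\le h,h'<p^\eta$, put $\alpha_\gamma(h,h')=\gamma$ if $h+h'\ge p^\eta$ and $\alpha_\gamma(h,h')=0$ if $h+h'<p^\eta$, and $$f_{\mathfrak{f}_0}(h,h')=\sum_{j=0}^{h-1}h'a^{h-j-1}\mathfrak{f}_0+\sum_{j=1}^{h-1}j\,h'\,b\,a^j\,\mathfrak{f}_0 .$$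 For $(\gamma,\mathfrak{f}_0)$ in the set of the claim, $E_{\gamma,\mathfrak{f}_0}$ is the linear cycle set with underlying set $I\times H$ and operations $(y,h)+(z,l)=(y+z+\alpha_\gamma(h,l),\,h+l)$ and $(y,h)\cdot(z,l)=(a^hz+f_{\mathfrak{f}_0}(h,l)+b\,a^h\,y\,l,\;l)$. One writes $y$ for $(y,0)$ and $w_h$ for $(0,h)$, so $y+w_h=(y,h)$. *)

theory Defs
  imports "HOL-Number_Theory.Number_Theory" "HOL-Algebra.Group"
begin

section \<open>Linear cycle sets\<close>

record 'a lcs = "'a partial_object" +
  ladd :: "'a \<Rightarrow> 'a \<Rightarrow> 'a"
  lzero :: 'a
  ldot :: "'a \<Rightarrow> 'a \<Rightarrow> 'a"

definition additive_group :: "('a, 'm) lcs_scheme \<Rightarrow> 'a monoid" where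
  "additive_group L = \<lparr>carrier = carrier L, mult = ladd L, one = lzero L\<rparr>"

definition linear_cycle_set :: "('a, 'm) lcs_scheme \<Rightarrow> bool" where
  "linear_cycle_set L \<longleftrightarrow>
     comm_group (additive_group L) \<and>
     (\<forall>l\<in>carrier L. bij_betw (ldot L l) (carrier L) (carrier L)) \<and>
     (\<forall>l\<in>carrier L. \<forall>m\<in>carrier L. \<forall>n\<in>carrier L.
        ldot L l (ladd L m n) = ladd L (ldot L l m) (ldot L l n)) \<and>
     (\<forall>l\<in>carrier L. \<forall>m\<in>carrier L. \<forall>n\<in>carrier L.
        ldot L (ladd L l m) n = ldot L (ldot L l m) (ldot L l n))"

definition Soc :: "('a, 'm) lcs_scheme \<Rightarrow> 'a set" where
  "Soc L = {x \<in> carrier L. \<forall>m\<in>carrier L. ldot L x m = m}"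

definition trivial_zmod :: "nat \<Rightarrow> nat lcs" where
  "trivial_zmod n =
     \<lparr>carrier = {0..<n}, ladd = (\<lambda>h l. (h + l) mod n), lzero = 0, ldot = (\<lambda>h l. l)\<rparr>"

section \<open>The integers attached to \<open>(a, b)\<close>\<close>

text \<open>Elements of \<open>\<int>/p\<^sup>r\<close> are represented by the integers in \<open>{0..<p^r}\<close>, elements of
  \<open>\<int>/p\<^sup>\<eta>\<close> by the natural numbers in \<open>{0..<p^\<eta>}\<close>, so that the latter can serve as exponents.\<close>

definition beta_exp :: "nat \<Rightarrow> nat \<Rightarrow> int \<Rightarrow> nat" where
  "beta_exp p r b = (if b = 0 then r else multiplicity (int p) b)"

text \<open>For \<open>a \<noteq> 1\<close> the exact power of \<open>p\<close> in \<open>a - 1\<close> is \<open>p^(u+1)\<close>; the truncated subtraction below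
  is harmless because \<open>p\<close> divides \<open>a - 1\<close> whenever \<open>a^(p^\<eta>) = 1\<close> modulo \<open>p^r\<close>.\<close>

definition u_exp :: "nat \<Rightarrow> nat \<Rightarrow> int \<Rightarrow> nat" where
  "u_exp p r a = (if a = 1 then r - 1 else multiplicity (int p) (a - 1) - 1)"

text \<open>For \<open>q \<le> r\<close>, divisibility by \<open>p^q\<close> in \<open>\<int>/p\<^sup>r\<close> is divisibility of any integer
  representative.\<close>

definition q_exp :: "nat \<Rightarrow> nat \<Rightarrow> int \<Rightarrow> int \<Rightarrow> nat" where
  "q_exp p r a b = (GREATEST q. q \<le> r \<and> int p ^ q dvd b * a + a - 1)"

definition param_set :: "nat \<Rightarrow> nat \<Rightarrow> int \<Rightarrow> int \<Rightarrow> (int \<times> int) set" where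
  "param_set p r a b =
     (let m = min (u_exp p r a + 1) (beta_exp p r b) in
      {(int p ^ (r - m) * z1, z2) | z1 z2.
         0 \<le> z1 \<and> z1 < int p ^ m \<and> 0 \<le> z2 \<and> z2 < int p ^ q_exp p r a b})"

section \<open>The extension \<open>E\<close>\<close>

definition carry :: "nat \<Rightarrow> nat \<Rightarrow> int \<Rightarrow> nat \<Rightarrow> nat \<Rightarrow> int" where
  "carry p \<eta> \<gamma> h h' = (if h + h' \<ge> p ^ \<eta> then \<gamma> else 0)"

text \<open>An integer representative; it is reduced modulo \<open>p^r\<close> where it is used.\<close>

definition f_map :: "int \<Rightarrow> int \<Rightarrow> int \<Rightarrow> nat \<Rightarrow> nat \<Rightarrow> int" where
  "f_map a b f0 h h' =
     (\<Sum>j<h. int h' * a ^ (h - j - 1) * f0) + (\<Sum>j=1..<h. int j * int h' * b * a ^ j * f0)"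

text \<open>\<open>H\<close> carries the trivial structure, so the second component of \<open>(y, h) \<cdot> (z, l)\<close> is
  \<open>h \<cdot> l = l\<close>. The pair \<open>(y, h)\<close> is the element \<open>y + w\<^sub>h\<close>.\<close>

definition ext_lcs ::
  "nat \<Rightarrow> nat \<Rightarrow> nat \<Rightarrow> int \<Rightarrow> int \<Rightarrow> int \<Rightarrow> int \<Rightarrow> (int \<times> nat) lcs" where
  "ext_lcs p r \<eta> a b \<gamma> f0 =
     (let H = trivial_zmod (p ^ \<eta>) in
      \<lparr>carrier = {0..<int p ^ r} \<times> carrier H,
       ladd = (\<lambda>(y, h) (z, l). ((y + z + carry p \<eta> \<gamma> h l) mod int p ^ r, ladd H h l)),
       lzero = (0, lzero H),
       ldot = (\<lambda>(y, h) (z, l).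
         ((a ^ h * z + f_map a b f0 h l + b * a ^ h * y * int l) mod int p ^ r, ldot H h l))\<rparr>)"

subsection \<open>\<open>E\<close> is a linear cycle set\<close>

definition f_coeff :: "int \<Rightarrow> int \<Rightarrow> nat \<Rightarrow> int" where
  "f_coeff a b h = (\<Sum>j<h. a ^ j) + b * (\<Sum>j<h. int j * a ^ j)"

lemma f_map_eq: "f_map a b f0 h l = int l * f0 * f_coeff a b h"
proof -
  have 1: "(\<Sum>j<h. int l * a ^ (h - j - 1) * f0) = int l * f0 * (\<Sum>j<h. a ^ j)"
    using sum.nat_diff_reindex[of "\<lambda>j. int l * a ^ j * f0" h]
    by (simp add: sum_distrib_left mult_ac)
  have "(\<Sum>j=1..<h. int j * int l * b * a ^ j * f0) = (\<Sum>j<h. int j * int l * b * a ^ j * f0)"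
    by (rule sum.mono_neutral_left) auto
  also have "\<dots> = int l * f0 * (b * (\<Sum>j<h. int j * a ^ j))"
    by (simp add: sum_distrib_left mult_ac)
  finally show ?thesis
    unfolding f_map_def f_coeff_def 1 by (simp add: algebra_simps)
qed

lemma geometric_add: "(\<Sum>j<h + k. a ^ j) = a ^ k * (\<Sum>j<h. a ^ j) + (\<Sum>j<k. (a::int) ^ j)"
  by (induction h) (simp_all add: algebra_simps power_add)

lemma weighted_geometric_add:
  "(\<Sum>j<h + k. int j * a ^ j) =
     a ^ k * (\<Sum>j<h. int j * a ^ j) + int k * a ^ k * (\<Sum>j<h. a ^ j) + (\<Sum>j<k. int j * a ^ j)"
  by (induction h) (simp_all add: algebra_simps power_add)

lemma f_coeff_add:
  "f_coeff a b (h + k) = a ^ k * f_coeff a b h + f_coeff a b k + b * int k * a ^ k * f_coeff a b h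
     - b\<^sup>2 * (int k * a ^ k * (\<Sum>j<h. int j * a ^ j))"
  unfolding f_coeff_def geometric_add weighted_geometric_add
  by (simp add: algebra_simps power2_eq_square)

lemma f_coeff_add_cong:
  assumes "[b\<^sup>2 = 0] (mod M)"
  shows "[f_coeff a b (h + k) =
    a ^ k * f_coeff a b h + f_coeff a b k + b * int k * a ^ k * f_coeff a b h] (mod M)"
  using assms unfolding f_coeff_add cong_iff_dvd_diff by simp

lemma geometric_mult:
  "(\<Sum>j<m * n. a ^ j) = (\<Sum>i<m. a ^ (i * n)) * (\<Sum>j<n. (a::int) ^ j)"
proof (induction m)
  case (Suc m)
  have "(\<Sum>j<n + m * n. a ^ j) = a ^ (m * n) * (\<Sum>j<n. a ^ j) + (\<Sum>j<m * n. a ^ j)"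
    by (rule geometric_add)
  with Suc show ?case by (simp add: algebra_simps)
qed simp

lemma weighted_geometric_mult:
  "(\<Sum>j<m * n. int j * a ^ j) = (\<Sum>i<m. a ^ (i * n)) * (\<Sum>j<n. int j * a ^ j)
     + int n * (\<Sum>j<n. a ^ j) * (\<Sum>i<m. int i * a ^ (i * n))"
proof (induction m)
  case (Suc m)
  have "(\<Sum>j<n + m * n. int j * a ^ j) = a ^ (m * n) * (\<Sum>j<n. int j * a ^ j)
     + int (m * n) * a ^ (m * n) * (\<Sum>j<n. a ^ j) + (\<Sum>j<m * n. int j * a ^ j)"
    by (rule weighted_geometric_add)
  with Suc show ?case by (simp add: algebra_simps)
qed simp

lemma geometric_sums_dvd:
  fixes p :: nat and a :: int
  assumes "odd p" and a: "[a = 1] (mod int p)"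
  shows "int p ^ n dvd (\<Sum>j<p ^ n. a ^ j) \<and> int p ^ n dvd (\<Sum>j<p ^ n. int j * a ^ j)"
proof (induction n)
  case (Suc n)
  have pow: "[a ^ k = 1] (mod int p)" for k
    using cong_pow[OF a, of k] by simp
  have "[(\<Sum>i<p. a ^ (i * p ^ n)) = (\<Sum>i<p. 1)] (mod int p)"
    by (intro cong_sum pow)
  then have d1: "int p dvd (\<Sum>i<p. a ^ (i * p ^ n))"
    by (simp add: cong_dvd_iff)
  have "[(\<Sum>i<p. int i * a ^ (i * p ^ n)) = (\<Sum>i<p. int i * 1)] (mod int p)"
    by (intro cong_sum cong_mult pow cong_refl)
  moreover have "int p dvd (\<Sum>i<p. int i)"
  proof -
    have "2 * (\<Sum>i<k. int i) = int k * (int k - 1)" for k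
      by (induction k) (simp_all add: algebra_simps)
    then have "int p dvd 2 * (\<Sum>i<p. int i)" by simp
    moreover have "coprime (int p) 2" using \<open>odd p\<close> by simp
    ultimately show ?thesis by (simp add: coprime_dvd_mult_right_iff)
  qed
  ultimately have d2: "int p dvd (\<Sum>i<p. int i * a ^ (i * p ^ n))"
    by (simp add: cong_dvd_iff)
  have "int p ^ n * int p dvd int p ^ n * (\<Sum>j<p ^ n. a ^ j) * (\<Sum>i<p. int i * a ^ (i * p ^ n))"
    by (rule mult_dvd_mono[OF _ d2]) simp
  then have "int p * int p ^ n dvd int (p ^ n) * (\<Sum>j<p ^ n. a ^ j) * (\<Sum>i<p. int i * a ^ (i * p ^ n))"
    by (simp only: mult.commute[of "int p"] of_nat_power)
  then show ?case
    unfolding power_Suc geometric_mult weighted_geometric_mult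
    using Suc d1 by (blast intro: mult_dvd_mono dvd_add)
qed simp

lemma one_of_pow_prime_pow:
  assumes "prime p" "1 \<le> r" "0 \<le> a" "[a ^ (p ^ \<eta>) = 1] (mod int p ^ r)"
  shows "[a = 1] (mod int p)"
proof -
  obtain n where n: "a = int n" using \<open>0 \<le> a\<close> nonneg_int_cases by blast
  have fermat: "[n ^ p = n] (mod p)"
  proof (cases "p dvd n")
    case True
    moreover have "p dvd n ^ p" using True prime_gt_0_nat[OF \<open>prime p\<close>] by (metis dvd_power dvd_trans)
    ultimately show ?thesis by (simp add: cong_def)
  next
    case False
    have "[n * n ^ (p - 1) = n * 1] (mod p)"
      by (intro cong_mult cong_refl fermat_theorem[OF \<open>prime p\<close> False])
    moreover have "n * n ^ (p - 1) = n ^ p"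
      using prime_gt_0_nat[OF \<open>prime p\<close>] by (simp add: power_eq_if)
    ultimately show ?thesis by simp
  qed
  have "[n ^ (p ^ k) = n] (mod p)" for k
  proof (induction k)
    case (Suc k)
    have "[(n ^ (p ^ k)) ^ p = n ^ p] (mod p)" by (rule cong_pow[OF Suc])
    from cong_trans[OF this fermat] show ?case
      by (simp only: power_Suc2 power_mult)
  qed simp
  then have "[a ^ (p ^ \<eta>) = a] (mod int p)"
    unfolding n by (metis cong_int_iff of_nat_power)
  moreover have "[a ^ (p ^ \<eta>) = 1] (mod int p)"
    using assms by (auto intro: cong_dvd_modulus)
  ultimately show ?thesis using cong_sym cong_trans by blast
qed

theorem linear_cycle_set_ext_lcs:
  fixes p r \<eta> :: nat and a b \<gamma> f0 :: int
  assumes p: "prime p" "odd p" and r: "1 \<le> r" "r \<le> \<eta>"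
    and ab: "a \<in> {0..<int p ^ r}" "b \<in> {0..<int p ^ r}"
    and apow: "[a ^ (p ^ \<eta>) = 1] (mod int p ^ r)"
    and bb: "[b\<^sup>2 = 0] (mod int p ^ r)"
    and params: "(\<gamma>, f0) \<in> param_set p r a b"
  shows "linear_cycle_set (ext_lcs p r \<eta> a b \<gamma> f0)"
proof -
  define M where "M = int p ^ r"
  define N where "N = p ^ \<eta>"
  define F where "F = f_coeff a b"
  define E where "E = ext_lcs p r \<eta> a b \<gamma> f0"
  define al where "al = carry p \<eta> \<gamma>"
  have M0: "M > 0" and N0: "N > 0"
    using prime_gt_0_nat[OF p(1)] by (auto simp: M_def N_def)
  have MN: "M dvd int N" using r by (simp add: M_def N_def le_imp_power_dvd)
  have a1: "[a = 1] (mod int p)"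
    using one_of_pow_prime_pow[OF p(1) r(1) _ apow] ab by simp
  have bb': "[b\<^sup>2 = 0] (mod M)" using bb by (simp add: M_def)
  have aN: "[a ^ N = 1] (mod M)" using apow by (simp add: M_def N_def)

  define m where "m = min (u_exp p r a + 1) (beta_exp p r b)"
  have g: "M dvd (a - 1) * \<gamma>" "M dvd b * \<gamma>"
  proof -
    obtain z where z: "\<gamma> = int p ^ (r - m) * z"
      using params by (auto simp: param_set_def m_def Let_def)
    have pa: "int p dvd a - 1" using a1 by (simp add: cong_iff_dvd_diff)
    have "int p ^ (u_exp p r a + 1) dvd a - 1"
    proof (cases "a = 1")
      case False
      have "\<not> is_unit (int p)" using prime_gt_1_nat[OF p(1)] by simp
      then have "multiplicity (int p) (a - 1) > 0"
        using False pa prime_gt_0_nat[OF p(1)] by (simp add: multiplicity_gt_zero_iff)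
      then show ?thesis using False by (simp add: u_exp_def multiplicity_dvd del: power_Suc)
    qed simp
    moreover have "int p ^ m dvd int p ^ (u_exp p r a + 1)"
      by (rule le_imp_power_dvd) (simp add: m_def)
    ultimately have ma: "int p ^ m dvd a - 1" by (rule dvd_trans[rotated])
    have "int p ^ beta_exp p r b dvd b" by (simp add: beta_exp_def multiplicity_dvd)
    moreover have "int p ^ m dvd int p ^ beta_exp p r b"
      by (rule le_imp_power_dvd) (simp add: m_def)
    ultimately have mb: "int p ^ m dvd b" by (rule dvd_trans[rotated])
    have "M dvd x * \<gamma>" if "int p ^ m dvd x" for x
    proof -
      have "M dvd int p ^ (m + (r - m))"
        unfolding M_def by (rule le_imp_power_dvd) simp
      also have "\<dots> dvd x * int p ^ (r - m)"
        unfolding power_add by (rule mult_dvd_mono[OF that dvd_refl])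
      also have "\<dots> dvd x * \<gamma>" by (simp add: z)
      finally show ?thesis .
    qed
    with ma mb show "M dvd (a - 1) * \<gamma>" "M dvd b * \<gamma>" by blast+
  qed
  have a_pow_gamma: "[a ^ h * \<gamma> = \<gamma>] (mod M)" for h
  proof (induction h)
    case (Suc h)
    have "[a * (a ^ h * \<gamma>) = a * \<gamma>] (mod M)" by (rule cong_mult[OF cong_refl Suc])
    moreover have "[a * \<gamma> = \<gamma>] (mod M)" using g(1) by (simp add: cong_iff_dvd_diff algebra_simps)
    ultimately have "[a * (a ^ h * \<gamma>) = \<gamma>] (mod M)" by (rule cong_trans)
    then show ?case by (simp add: mult.assoc)
  qed simp
  have a_pow_al: "[a ^ h * al k l = al k l] (mod M)" for h k l
    using a_pow_gamma by (simp add: al_def carry_def)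
  have b_al: "[b * al k l = 0] (mod M)" for k l
    using g(2) by (simp add: al_def carry_def cong_0_iff)

  have "M dvd (\<Sum>j<N. a ^ j)" "M dvd (\<Sum>j<N. int j * a ^ j)"
    using geometric_sums_dvd[OF p(2) a1, of \<eta>] MN
    by (auto simp: N_def intro: dvd_trans)
  then have FN: "[F N = 0] (mod M)"
    unfolding F_def f_coeff_def cong_0_iff by (intro dvd_add dvd_mult)
  have Fadd: "[F (h + k) = a ^ k * F h + F k + b * int k * a ^ k * F h] (mod M)" for h k
    unfolding F_def by (rule f_coeff_add_cong[OF bb'])
  have FaddN: "[F (h + N) = F h] (mod M)" for h
  proof -
    have "M dvd b * int N * a ^ N * F h"
      using MN by (metis dvd_mult dvd_mult2)
    moreover have "M dvd (a ^ N - 1) * F h"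
      using aN by (simp add: cong_iff_dvd_diff)
    moreover have "M dvd F N" using FN by (simp add: cong_0_iff)
    ultimately have "M dvd (a ^ N - 1) * F h + F N + b * int N * a ^ N * F h"
      by (intro dvd_add)
    then have "[a ^ N * F h + F N + b * int N * a ^ N * F h = F h] (mod M)"
      by (simp add: cong_iff_dvd_diff algebra_simps)
    with Fadd show ?thesis using cong_trans by blast
  qed
  have mod_cases: "(h + k) mod N = h + k \<or> h + k = (h + k) mod N + N" if "h < N" "k < N" for h k
  proof (cases "h + k < N")
    case False
    then have "(h + k) mod N = h + k - N"
      using that by (subst mod_if, subst mod_less) auto
    with False show ?thesis by simp
  qed simp
  have Fmod: "[F ((h + k) mod N) = F (h + k)] (mod M)" if "h < N" "k < N" for h k
    using mod_cases[OF that] FaddN by (metis cong_refl cong_sym)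
  have apmod: "[a ^ ((h + k) mod N) = a ^ h * a ^ k] (mod M)" if "h < N" "k < N" for h k
  proof -
    have "[a ^ (x + N) = a ^ x] (mod M)" for x
      unfolding power_add using cong_mult[OF cong_refl aN, of "a ^ x"] by simp
    then show ?thesis
      using mod_cases[OF that] by (metis cong_refl cong_sym power_add)
  qed
  have intmod: "[int ((h + k) mod N) = int h + int k] (mod M)" for h k
  proof -
    have "[int ((h + k) mod N) = int (h + k)] (mod int N)"
      by (simp add: cong_def of_nat_mod)
    then show ?thesis using MN cong_dvd_modulus by auto
  qed

  have car: "carrier E = {0..<M} \<times> {0..<N}"
    by (simp add: E_def ext_lcs_def trivial_zmod_def Let_def M_def N_def)
  have add: "ladd E (y, h) (z, l) = ((y + z + al h l) mod M, (h + l) mod N)" for y z h l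
    by (simp add: E_def ext_lcs_def trivial_zmod_def Let_def M_def N_def al_def)
  have dot: "ldot E (y, h) (z, l) =
      ((a ^ h * z + int l * f0 * F h + b * a ^ h * y * int l) mod M, l)" for y z h l
    by (simp add: E_def ext_lcs_def trivial_zmod_def Let_def M_def f_map_eq F_def)
  have zero: "lzero E = (0, 0)"
    by (simp add: E_def ext_lcs_def trivial_zmod_def Let_def)

  have "comm_group (additive_group E)"
  proof (rule comm_groupI, unfold additive_group_def, simp_all)
    show "\<And>x y. x \<in> carrier E \<Longrightarrow> y \<in> carrier E \<Longrightarrow> ladd E x y \<in> carrier E"
      using M0 N0 by (auto simp: car add)
    show "lzero E \<in> carrier E" using M0 N0 by (simp add: car zero)
    show "\<And>x. x \<in> carrier E \<Longrightarrow> ladd E (lzero E) x = x"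
      by (auto simp: car add zero al_def carry_def N_def)
    show "\<And>x y. x \<in> carrier E \<Longrightarrow> y \<in> carrier E \<Longrightarrow> ladd E x y = ladd E y x"
      by (auto simp: add al_def carry_def ac_simps)
    show "\<exists>y\<in>carrier E. ladd E y x = lzero E" if mem: "x \<in> carrier E" for x
    proof -
      obtain y h where x: "x = (y, h)" "h < N" using mem by (cases x) (simp add: car)
      define h' where "h' = (N - h) mod N"
      have "h' < N" using N0 by (simp add: h'_def)
      moreover have "(h' + h) mod N = 0" using x(2) by (simp add: h'_def mod_add_left_eq)
      ultimately have "((- y - al h' h) mod M, h') \<in> carrier E"
        "ladd E ((- y - al h' h) mod M, h') x = lzero E"
        using M0 mod_add_left_eq[of "- y - al h' h" M "y + al h' h"]
        by (simp_all add: car add zero x add.assoc)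
      then show ?thesis by blast
    qed
    show "ladd E (ladd E x y) z = ladd E x (ladd E y z)"
      if mem: "x \<in> carrier E" "y \<in> carrier E" "z \<in> carrier E" for x y z
    proof -
      obtain x1 h y1 k z1 l where *: "x = (x1, h)" "y = (y1, k)" "z = (z1, l)"
        "h < N" "k < N" "l < N" using mem by (cases x; cases y; cases z) (simp add: car)
      define s t where "s = (h + k) mod N" and "t = (k + l) mod N"
      have "s < N" "t < N" "s = h + k \<or> h + k = s + N" "t = k + l \<or> k + l = t + N"
        using mod_cases[OF *(4,5)] mod_cases[OF *(5,6)] N0 by (simp_all add: s_def t_def)
      then have "al h k + al s l = al k l + al h t"
        unfolding al_def carry_def N_def[symmetric] using *(4-6) by auto
      then have "al h k + al ((h + k) mod N) l = al k l + al h ((k + l) mod N)"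
        by (simp only: s_def t_def)
      then have eq: "x1 + y1 + al h k + (z1 + al ((h + k) mod N) l)
          = y1 + z1 + al k l + (x1 + al h ((k + l) mod N))"
        by linarith
      have "((x1 + y1 + al h k) mod M + z1 + al ((h + k) mod N) l) mod M
          = (x1 + y1 + al h k + (z1 + al ((h + k) mod N) l)) mod M"
        by (simp only: add.assoc[of "_ mod M"] mod_add_left_eq)
      also have "\<dots> = ((y1 + z1 + al k l) mod M + (x1 + al h ((k + l) mod N))) mod M"
        unfolding eq by (rule mod_add_left_eq[symmetric])
      also have "\<dots> = (x1 + (y1 + z1 + al k l) mod M + al h ((k + l) mod N)) mod M"
        by (simp only: ac_simps)
      finally show ?thesis by (simp add: * add mod_add_left_eq mod_add_right_eq add.assoc)
    qed
  qed
  moreover have "bij_betw (ldot E x) (carrier E) (carrier E)" if "x \<in> carrier E" for x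
  proof -
    obtain y h where x: "x = (y, h)" by fastforce
    have cop: "coprime (a ^ h) M"
    proof -
      have "coprime (a ^ N) M" using cong_imp_coprime[OF cong_sym[OF aN]] by simp
      then show ?thesis using N0 by (simp add: coprime_power_left_iff)
    qed
    have "inj_on (ldot E x) (carrier E)"
    proof (rule inj_onI)
      fix s t assume st: "s \<in> carrier E" "t \<in> carrier E" "ldot E x s = ldot E x t"
      obtain z l z' l' where zz: "s = (z, l)" "t = (z', l')" by fastforce
      from st(3) have l: "l = l'" and
        "[a ^ h * z + (int l * f0 * F h + b * a ^ h * y * int l) =
          a ^ h * z' + (int l * f0 * F h + b * a ^ h * y * int l)] (mod M)"
        by (auto simp: x zz dot cong_def add.assoc)
      then have "[a ^ h * z = a ^ h * z'] (mod M)" using cong_add_rcancel by blast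
      then have "[z = z'] (mod M)" using cop by (simp add: cong_mult_lcancel)
      then have "z = z'" using st(1,2) by (simp add: zz car cong_def)
      with l zz show "s = t" by simp
    qed
    moreover have "ldot E x ` carrier E \<subseteq> carrier E"
      using M0 by (auto simp: car x dot)
    moreover have "finite (carrier E)" by (simp add: car)
    ultimately show ?thesis by (simp add: bij_betw_def endo_inj_surj)
  qed
  moreover have "ldot E x (ladd E s t) = ladd E (ldot E x s) (ldot E x t)"
    if "x \<in> carrier E" "s \<in> carrier E" "t \<in> carrier E" for x s t
  proof -
    obtain y h z k w l where *: "x = (y, h)" "s = (z, k)" "t = (w, l)" by (metis surj_pair)
    have "[a ^ h * ((z + w + al k l) mod M) + int ((k + l) mod N) * f0 * F h
         + b * a ^ h * y * int ((k + l) mod N)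
       = a ^ h * (z + w + al k l) + (int k + int l) * f0 * F h
         + b * a ^ h * y * (int k + int l)] (mod M)"
      by (intro cong_add cong_mult cong_refl intmod) (simp add: cong_def)
    also have "a ^ h * (z + w + al k l) + (int k + int l) * f0 * F h + b * a ^ h * y * (int k + int l)
       = (a ^ h * z + int k * f0 * F h + b * a ^ h * y * int k)
         + (a ^ h * w + int l * f0 * F h + b * a ^ h * y * int l) + a ^ h * al k l"
      by (simp add: algebra_simps)
    also have "[\<dots> = (a ^ h * z + int k * f0 * F h + b * a ^ h * y * int k) mod M
         + (a ^ h * w + int l * f0 * F h + b * a ^ h * y * int l) mod M + al k l] (mod M)"
      by (intro cong_add a_pow_al) (simp_all add: cong_def)
    finally show ?thesis by (simp add: * add dot cong_def)
  qed
  moreover have "ldot E (ladd E x s) t = ldot E (ldot E x s) (ldot E x t)"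
    if mem: "x \<in> carrier E" "s \<in> carrier E" "t \<in> carrier E" for x s t
  proof -
    obtain y h z k w l where *: "x = (y, h)" "s = (z, k)" "t = (w, l)" "h < N" "k < N"
      using mem by (cases x; cases s; cases t) (simp add: car)
    define A where "A = a ^ h"
    define B where "B = a ^ k"
    define X where "X = A * z + int k * f0 * F h + b * A * y * int k"
    define Y where "Y = A * w + int l * f0 * F h + b * A * y * int l"
    have "[a ^ ((h + k) mod N) * w + int l * f0 * F ((h + k) mod N)
          + b * a ^ ((h + k) mod N) * ((y + z + al h k) mod M) * int l
       = (A * B) * w + int l * f0 * F (h + k) + b * (A * B) * (y + z + al h k) * int l] (mod M)"
      unfolding A_def B_def
      by (intro cong_add cong_mult cong_refl apmod Fmod *) (simp add: cong_def)
    also have "[(A * B) * w + int l * f0 * F (h + k) + b * (A * B) * (y + z + al h k) * int l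
       = (A * B) * w + int l * f0 * (B * F h + F k + b * int k * B * F h)
          + b * (A * B) * (y + z + al h k) * int l] (mod M)"
      using Fadd[of h k] unfolding A_def B_def by (intro cong_add cong_mult cong_refl)
    also have "[(A * B) * w + int l * f0 * (B * F h + F k + b * int k * B * F h)
          + b * (A * B) * (y + z + al h k) * int l
       = B * Y + int l * f0 * F k + b * B * X * int l] (mod M)"
    proof -
      have "M dvd (b * al h k) * (A * B * int l)" using b_al by (simp add: cong_0_iff)
      moreover have "M dvd b\<^sup>2 * (A * B * y * int k * int l)" using bb' by (simp add: cong_0_iff)
      ultimately have "M dvd (b * al h k) * (A * B * int l) - b\<^sup>2 * (A * B * y * int k * int l)"
        by (rule dvd_diff)
      then show ?thesis
        unfolding X_def Y_def cong_iff_dvd_diff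
        by (simp add: algebra_simps power2_eq_square)
    qed
    also have "[B * Y + int l * f0 * F k + b * B * X * int l
       = B * (Y mod M) + int l * f0 * F k + b * B * (X mod M) * int l] (mod M)"
      by (intro cong_add cong_mult cong_refl) (simp_all add: cong_def)
    finally show ?thesis by (simp add: * add dot cong_def A_def B_def X_def Y_def)
  qed
  ultimately show ?thesis unfolding linear_cycle_set_def E_def by blast
qed

end

theory Submission
  imports Defs
begin

text \<open>
  Write \<open>S = \<Sum>j<h. a^j\<close> and \<open>T = \<Sum>j<h. j * a^j\<close>. Testing \<open>(y, h)\<close> against \<open>(1, 0)\<close> and \<open>(0, 1)\<close>
  shows that it lies in the socle iff \<open>a^h = 1\<close> and \<open>f0 * (S + b * T) + b * y = 0\<close>.
  The identity \<open>S - h = (a - 1) * ((h - 1) * S - T)\<close> implies that \<open>S\<close> and \<open>h\<close> are divisible by the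
  same powers of \<open>p\<close>; as \<open>a^h - 1 = (a - 1) * S\<close>, this turns \<open>a^h = 1\<close> into the divisibility
  condition on \<open>h\<close>, under which the same identity gives \<open>S = h\<close>. Finally, multiplying either form of
  the second condition by \<open>b\<close> and using \<open>b\<^sup>2 = 0\<close> gives \<open>b * f0 * h = 0\<close>, hence \<open>b * f0 * T = 0\<close>.
\<close>

text \<open>Passing from \<open>h\<close> to \<open>Suc h\<close> adds \<open>a ^ h - 1\<close> on
  both sides: on the right the \<open>a ^ h\<close> terms cancel inside the bracket, which grows by
  the geometric sum alone.\<close>

lemma geometric_sum_minus_length:
  "(\<Sum>j<h. a ^ j) - int h = (a - 1) * ((int h - 1) * (\<Sum>j<h. a ^ j) - (\<Sum>j<h. int j * a ^ j))"
proof (induction h)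
  case (Suc h)
  have "a ^ h - 1 = (a - 1) * (\<Sum>j<h. a ^ j)"
    by (rule power_diff_1_eq)
  moreover have "(a - 1) * ((int (Suc h) - 1) * (\<Sum>j<Suc h. a ^ j) - (\<Sum>j<Suc h. int j * a ^ j))
      = (a - 1) * ((int h - 1) * (\<Sum>j<h. a ^ j) - (\<Sum>j<h. int j * a ^ j))
        + (a - 1) * (\<Sum>j<h. a ^ j)"
    by (simp add: algebra_simps)
  ultimately show ?case using Suc by simp
qed simp

text \<open>Cutting the range into blocks of length \<open>p ^ k\<close> reduces to the case
  \<open>h = p ^ k\<close>; the extra term of the weighted sum carries the block length as a
  factor.\<close>

lemma geometric_sums_dvd_of_dvd:
  fixes p :: nat and a :: int
  assumes "odd p" "[a = 1] (mod int p)" "p ^ k dvd h"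
  shows "int p ^ k dvd (\<Sum>j<h. a ^ j)" "int p ^ k dvd (\<Sum>j<h. int j * a ^ j)"
proof -
  obtain m where "h = m * p ^ k"
    using assms(3) by (metis dvd_def mult.commute)
  then show "int p ^ k dvd (\<Sum>j<h. a ^ j)" "int p ^ k dvd (\<Sum>j<h. int j * a ^ j)"
    using geometric_sums_dvd[OF assms(1,2), of k]
    by (simp_all add: geometric_mult weighted_geometric_mult)
qed

text \<open>In the identity for the difference, \<open>a - 1\<close> supplies \<open>p ^ n\<close>
  and the bracket supplies \<open>p ^ k\<close>.\<close>

lemma geometric_sum_cong_length:
  fixes p :: nat and a :: int
  assumes "odd p" "[a = 1] (mod int p)" "p ^ k dvd h" "int p ^ n dvd a - 1"
  shows "[(\<Sum>j<h. a ^ j) = int h] (mod int p ^ (n + k))"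
  unfolding cong_iff_dvd_diff geometric_sum_minus_length power_add
  by (intro mult_dvd_mono dvd_diff dvd_mult assms(4) geometric_sums_dvd_of_dvd[OF assms(1-3)])

lemma prime_power_dvd_geometric_sum_iff:
  fixes p :: nat and a :: int
  assumes "odd p" and a: "[a = 1] (mod int p)"
  shows "int p ^ k dvd (\<Sum>j<h. a ^ j) \<longleftrightarrow> p ^ k dvd h"
proof
  show "p ^ k dvd h" if "int p ^ k dvd (\<Sum>j<h. a ^ j)"
    using that
  proof (induction k)
    case (Suc k)
    have "int p ^ k dvd (\<Sum>j<h. a ^ j)"
      using Suc.prems by (rule power_le_dvd) simp
    then have "p ^ k dvd h" by (rule Suc.IH)
    \<comment> \<open>This one factor \<open>p\<close> lifts the congruence between sum and length
      to modulus \<open>p ^ Suc k\<close>, so the next power passes to \<open>h\<close>.\<close>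
    moreover have "int p ^ 1 dvd a - 1" using a by (simp add: cong_iff_dvd_diff)
    ultimately have "[(\<Sum>j<h. a ^ j) = int h] (mod int p ^ (1 + k))"
      by (rule geometric_sum_cong_length[OF assms])
    with Suc.prems have "int p ^ Suc k dvd int h" by (simp add: cong_dvd_iff)
    then show ?case by (metis of_nat_dvd_iff of_nat_power)
  qed simp
qed (rule geometric_sums_dvd_of_dvd[OF assms])

text \<open>Modulo \<open>p ^ r\<close> only \<open>gcd h (p ^ r) = p ^ k\<close> matters:
  \<open>p ^ r\<close> divides \<open>c * p ^ k\<close>, and \<open>p ^ k\<close> divides the
  weighted sum. It is used to remove the \<open>b * T\<close> term.\<close>

lemma dvd_mult_weighted_geometric_sum:
  fixes p :: nat and a c :: int
  assumes "prime p" "odd p" "[a = 1] (mod int p)" and c: "int p ^ r dvd c * int h"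
  shows "int p ^ r dvd c * (\<Sum>j<h. int j * a ^ j)"
proof -
  obtain k where k: "gcd h (p ^ r) = p ^ k"
    using divides_primepow_nat[OF \<open>prime p\<close>] by blast
  have "int p ^ r dvd gcd (c * int h) (c * int p ^ r)"
    using c by simp
  also have "\<dots> dvd c * gcd (int h) (int p ^ r)"
    by (simp add: gcd_mult_left)
  also have "gcd (int h) (int p ^ r) = int p ^ k"
    using k by (metis gcd_int_int_eq of_nat_power)
  also have "c * int p ^ k dvd c * (\<Sum>j<h. int j * a ^ j)"
    using k by (intro mult_dvd_mono geometric_sums_dvd_of_dvd assms) (simp, metis gcd_dvd1)
  finally show ?thesis .
qed

lemma u_exp_bounds:
  assumes "prime p" "1 \<le> r" "a \<in> {0..<int p ^ r}" "[a = 1] (mod int p)"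
  obtains s where "a - 1 = int p ^ (u_exp p r a + 1) * s" "u_exp p r a + 1 \<le> r"
    "a \<noteq> 1 \<Longrightarrow> coprime (int p) s"
proof (cases "a = 1")
  case True
  with \<open>1 \<le> r\<close> show ?thesis by (intro that[of 0]) (simp_all add: u_exp_def)
next
  case False
  define v where "v = multiplicity (int p) (a - 1)"
  have p: "prime (int p)" using \<open>prime p\<close> by simp
  have dvd: "int p dvd a - 1" using assms(4) by (simp add: cong_iff_dvd_diff)
  have "v > 0"
    using False dvd p prime_elem_multiplicity_eq_zero_iff[of "int p" "a - 1"]
    by (auto simp: v_def)
  then have v: "u_exp p r a + 1 = v" using False by (simp add: u_exp_def v_def)
  obtain s where s: "a - 1 = int p ^ v * s" "\<not> int p dvd s"
    unfolding v_def using multiplicity_decompose'[of "a - 1" "int p"] False p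
    by (metis eq_iff_diff_eq_0 not_prime_unit)
  \<comment> \<open>Excluding \<open>a = 0\<close> makes \<open>a - 1\<close> a positive integer
    below \<open>p ^ r\<close>, which bounds its multiplicity \<open>v\<close>.\<close>
  have "a \<noteq> 0" using dvd prime_gt_1_nat[OF \<open>prime p\<close>] by auto
  with False assms(3) have "0 < a - 1" "a - 1 < int p ^ r" by auto
  moreover have "int p ^ v dvd a - 1" using s by simp
  ultimately have "int p ^ v < int p ^ r" by (meson le_less_trans zdvd_imp_le)
  then have "v \<le> r" using prime_gt_1_nat[OF \<open>prime p\<close>] by simp
  moreover have "coprime (int p) s" using p s(2) by (rule prime_imp_coprime)
  ultimately show ?thesis using s(1) v by (intro that[of s]) simp_all
qed

lemma power_cong_1_iff:
  assumes "prime p" "odd p" "1 \<le> r" "a \<in> {0..<int p ^ r}" "[a = 1] (mod int p)"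
  shows "[a ^ h = 1] (mod int p ^ r) \<longleftrightarrow> p ^ (r - u_exp p r a - 1) dvd h"
proof (cases "a = 1")
  case True
  \<comment> \<open>The default \<open>u = r - 1\<close> makes the divisor \<open>p ^ 0 = 1\<close>,
    so both sides hold.\<close>
  then show ?thesis by (simp add: u_exp_def)
next
  case False
  obtain s where s: "a - 1 = int p ^ (u_exp p r a + 1) * s" "u_exp p r a + 1 \<le> r"
    "coprime (int p) s"
    using u_exp_bounds[OF assms(1,3,4,5)] False by metis
  define k where "k = r - u_exp p r a - 1"
  have r: "r = (u_exp p r a + 1) + k" using s(2) by (simp add: k_def)
  have p0: "int p ^ (u_exp p r a + 1) \<noteq> 0" using prime_gt_0_nat[OF assms(1)] by simp
  have "[a ^ h = 1] (mod int p ^ r) \<longleftrightarrow> int p ^ r dvd (a - 1) * (\<Sum>j<h. a ^ j)"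
    by (simp add: cong_iff_dvd_diff power_diff_1_eq)
  also have "\<dots> \<longleftrightarrow> int p ^ (u_exp p r a + 1) * int p ^ k dvd
      int p ^ (u_exp p r a + 1) * (s * (\<Sum>j<h. a ^ j))"
    \<comment> \<open>Only the exponent of the modulus is split; \<open>r\<close> also occurs inside
      \<open>u_exp\<close>.\<close>
    unfolding s(1) by (subst (1) r) (simp only: power_add mult.assoc)
  also have "\<dots> \<longleftrightarrow> int p ^ k dvd s * (\<Sum>j<h. a ^ j)"
    using p0 by (simp only: dvd_mult_cancel_left simp_thms)
  also have "\<dots> \<longleftrightarrow> int p ^ k dvd (\<Sum>j<h. a ^ j)"
    using s(3) by (simp add: coprime_dvd_mult_right_iff)
  also have "\<dots> \<longleftrightarrow> p ^ k dvd h"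
    by (rule prime_power_dvd_geometric_sum_iff[OF assms(2,5)])
  finally show ?thesis unfolding k_def .
qed

lemma f_coeff_condition_iff:
  fixes p r h :: nat and a b c y :: int
  assumes "prime p" "odd p" "[a = 1] (mod int p)"
    and bb: "[b\<^sup>2 = 0] (mod int p ^ r)"
    and S: "[(\<Sum>j<h. a ^ j) = int h] (mod int p ^ r)"
  shows "[c * f_coeff a b h + b * y = 0] (mod int p ^ r) \<longleftrightarrow>
    [int h * c = - (b * y)] (mod int p ^ r)"
proof -
  define M where "M = int p ^ r"
  define T where "T = (\<Sum>j<h. int j * a ^ j)"
  have bb': "M dvd b\<^sup>2 * x" for x using bb by (simp add: M_def cong_0_iff)
  have F: "M dvd c * f_coeff a b h - (c * int h + c * b * T)"
  proof -
    have "M dvd c * ((\<Sum>j<h. a ^ j) - int h)"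
      using S by (simp add: M_def cong_iff_dvd_diff)
    then show ?thesis by (simp add: f_coeff_def T_def algebra_simps)
  qed
  have T: "M dvd c * b * T" if "M dvd c * b * int h"
    using dvd_mult_weighted_geometric_sum[OF assms(1-3)] that by (simp add: M_def T_def)
  show ?thesis
  proof
    assume "[c * f_coeff a b h + b * y = 0] (mod int p ^ r)"
    then have "M dvd (c * f_coeff a b h + b * y) - (c * f_coeff a b h - (c * int h + c * b * T))"
      by (intro dvd_diff[OF _ F]) (simp add: M_def cong_0_iff)
    then have *: "M dvd c * int h + c * b * T + b * y" by (simp add: algebra_simps)
    \<comment> \<open>What remains is \<open>c * b * int h\<close>, exactly the hypothesis of
      \<open>T\<close>.\<close>
    then have "M dvd b * (c * int h + c * b * T + b * y) - b\<^sup>2 * (c * T + y)"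
      by (intro dvd_diff[OF dvd_mult bb'])
    then have "M dvd c * b * T" by (intro T) (simp add: algebra_simps power2_eq_square)
    with * have "M dvd (c * int h + c * b * T + b * y) - c * b * T" by (rule dvd_diff)
    then show "[int h * c = - (b * y)] (mod int p ^ r)"
      by (simp add: M_def cong_iff_dvd_diff algebra_simps)
  next
    assume "[int h * c = - (b * y)] (mod int p ^ r)"
    then have *: "M dvd c * int h + b * y"
      by (simp add: M_def cong_iff_dvd_diff algebra_simps)
    then have "M dvd b * (c * int h + b * y) - b\<^sup>2 * y"
      by (intro dvd_diff[OF dvd_mult bb'])
    then have "M dvd c * b * T" by (intro T) (simp add: algebra_simps power2_eq_square)
    from dvd_add[OF dvd_add[OF * this] F]
    have "M dvd c * f_coeff a b h + b * y" by (simp add: algebra_simps)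
    then show "[c * f_coeff a b h + b * y = 0] (mod int p ^ r)"
      by (simp add: M_def cong_0_iff)
  qed
qed

lemma mem_Soc_ext_lcs_iff:
  fixes p r \<eta> h :: nat and a b \<gamma> f0 y :: int
  assumes "1 < p" "1 \<le> r" "1 \<le> \<eta>"
    and mem: "(y, h) \<in> carrier (ext_lcs p r \<eta> a b \<gamma> f0)"
  shows "(y, h) \<in> Soc (ext_lcs p r \<eta> a b \<gamma> f0) \<longleftrightarrow>
    [a ^ h = 1] (mod int p ^ r) \<and> [f0 * f_coeff a b h + b * y = 0] (mod int p ^ r)"
proof -
  define M where "M = int p ^ r"
  define N where "N = p ^ \<eta>"
  define E where "E = ext_lcs p r \<eta> a b \<gamma> f0"
  define F where "F = f_coeff a b h"
  \<comment> \<open>Strictness puts the test elements \<open>(1, 0)\<close> and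
    \<open>(0, 1)\<close> in the carrier.\<close>
  have M1: "1 < M" and N1: "1 < N"
    using assms(1-3) by (simp_all add: M_def N_def one_less_power del: One_nat_def)
  have car: "carrier E = {0..<M} \<times> {0..<N}"
    by (simp add: E_def ext_lcs_def trivial_zmod_def Let_def M_def N_def)
  have dot: "ldot E (y, h) (z, l) = ((a ^ h * z + int l * f0 * F + b * a ^ h * y * int l) mod M, l)"
    for z l
    by (simp add: E_def ext_lcs_def trivial_zmod_def Let_def M_def f_map_eq F_def)
  have by_cong: "[f0 * F + b * a ^ h * y = f0 * F + b * y] (mod M)" if "[a ^ h = 1] (mod M)"
    using cong_add[OF cong_refl cong_mult[OF cong_mult[OF cong_refl that] cong_refl]]
    by (metis mult.right_neutral)
  have "(y, h) \<in> Soc E \<longleftrightarrow> [a ^ h = 1] (mod M) \<and> [f0 * F + b * y = 0] (mod M)"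
  proof
    assume "(y, h) \<in> Soc E"
    then have *: "ldot E (y, h) m = m" if "m \<in> carrier E" for m
      using that by (simp add: Soc_def)
    have "[a ^ h = 1] (mod M)"
      using *[of "(1, 0)"] M1 N1 by (simp add: car dot cong_def)
    moreover have "[f0 * F + b * a ^ h * y = 0] (mod M)"
      using *[of "(0, 1)"] M1 N1 by (simp add: car dot cong_def)
    ultimately show "[a ^ h = 1] (mod M) \<and> [f0 * F + b * y = 0] (mod M)"
      using by_cong cong_trans cong_sym by blast
  next
    assume ah: "[a ^ h = 1] (mod M) \<and> [f0 * F + b * y = 0] (mod M)"
    then have ah0: "[f0 * F + b * a ^ h * y = 0] (mod M)"
      using by_cong cong_trans by blast
    have "ldot E (y, h) (z, l) = (z, l)" if "(z, l) \<in> carrier E" for z l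
    proof -
      \<comment> \<open>The first coordinate is linear in \<open>z\<close> and \<open>l\<close>, and
        the two conditions fix its coefficients as 1 and 0.\<close>
      have "[a ^ h * z + int l * (f0 * F + b * a ^ h * y) = 1 * z + int l * 0] (mod M)"
        by (intro cong_add cong_mult cong_refl ah0 conjunct1[OF ah])
      then have "(a ^ h * z + int l * f0 * F + b * a ^ h * y * int l) mod M = z mod M"
        by (simp add: cong_def algebra_simps)
      then show ?thesis using that by (simp add: dot car)
    qed
    with mem show "(y, h) \<in> Soc E" by (auto simp: Soc_def E_def)
  qed
  then show ?thesis by (simp only: E_def M_def F_def)
qed

theorem proposition2p7:
  fixes p r \<eta> :: nat and a b \<gamma> f0 :: int
  assumes "prime p" and "odd p" and "1 \<le> r" and "r \<le> \<eta>"
    and "a \<in> {0..<int p ^ r}" and "b \<in> {0..<int p ^ r}"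
    and "[a ^ (p ^ \<eta>) = 1] (mod int p ^ r)"
    and "[int p ^ \<eta> * b = 0] (mod int p ^ r)"
    and "[b\<^sup>2 = 0] (mod int p ^ r)"
    and "(\<gamma>, f0) \<in> param_set p r a b"
  shows "Soc (ext_lcs p r \<eta> a b \<gamma> f0) =
    {(y, h) \<in> carrier (ext_lcs p r \<eta> a b \<gamma> f0).
       p ^ (r - u_exp p r a - 1) dvd h \<and> [int h * f0 = - (b * y)] (mod int p ^ r)}"
proof -
  define k where "k = r - u_exp p r a - 1"
  have a1: "[a = 1] (mod int p)"
    using one_of_pow_prime_pow[OF assms(1,3) _ assms(7)] assms(5) by simp
  obtain s where s: "a - 1 = int p ^ (u_exp p r a + 1) * s" "u_exp p r a + 1 \<le> r"
    using u_exp_bounds[OF assms(1,3,5) a1] by metis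
  have S: "[(\<Sum>j<h. a ^ j) = int h] (mod int p ^ r)" if "p ^ k dvd h" for h
    using geometric_sum_cong_length[OF assms(2) a1 that, of "u_exp p r a + 1"] s
    by (simp add: k_def)
  have iff: "(y, h) \<in> Soc (ext_lcs p r \<eta> a b \<gamma> f0) \<longleftrightarrow>
      p ^ k dvd h \<and> [int h * f0 = - (b * y)] (mod int p ^ r)"
    if "(y, h) \<in> carrier (ext_lcs p r \<eta> a b \<gamma> f0)" for y h
  proof -
    have "1 \<le> \<eta>" using assms(3,4) by simp
    from mem_Soc_ext_lcs_iff[OF prime_gt_1_nat[OF assms(1)] assms(3) this that]
    show ?thesis
      \<comment> \<open>The fact \<open>S\<close> assumes \<open>p ^ k dvd h\<close>, so the second
        conditions are compared only once the first holds.\<close>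
      using power_cong_1_iff[OF assms(1,2,3,5) a1, of h]
        f_coeff_condition_iff[OF assms(1,2) a1 assms(9) S, of h f0 y]
      by (auto simp: k_def)
  qed
  have "Soc (ext_lcs p r \<eta> a b \<gamma> f0) \<subseteq> carrier (ext_lcs p r \<eta> a b \<gamma> f0)"
    by (auto simp: Soc_def)
  with iff show ?thesis unfolding k_def by auto
qed

end
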